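(* Let $(S,\mu)$ be a directed metric space with $S$ finite, and let $(V,d)$ be an extension of $(S,\mu)$. (1) $d$ is tight if and only if there exists an isometric embedding $\rho: (V,d) \to (T_\mu, D_\infty)$ such that $\rho(s) = \mu_s$ for all $s \in S$. (2) $d$ is cyclically tight if and only if there exists an isometric embedding $\rho: (V,d) \to (Q_\mu^+, D_\infty)$ such that $\rho(s) = \mu_s$ for all $s \in S$ and $\rho(V)$ is balanced. Moreover, if $d$ is tight, then such an isometric embedding $\rho$ coincides with the map $x \mapsto d_x$ $(x \in V)$.
   Context: A directed distance on a set $V$ is a function $d: V\times V \to \mathbf{R}_{+}$ (nonnegative reals) with $d(x,x)=0$ for all $x$; it need not be symmetric, and $d(x,y)=0$ is allowed for $x\neq y$. A directed metric is a directed distance satisfying $d(x,y)+d(y,z)\ge d(x,z)$ for all $x,y,z$; a directed metric space is a set with a directed metric. An isometric embedding from $(V,d)$ to $(V',d')$ is a map $\rho:V\to V'$ with $d'(\rho(x),\rho(y))=d(x,y)$ for all ordered pairs $x,y\in V$ (not required to be injective). A directed metric space $(V,d)$ is an extension of $(S,\mu)$ if $S\subseteq V$ and $d(s,t)=\mu(s,t)$ for all $s,t\in S$. It is tight if there is no extension $(V,d')$ of $(S,\mu)$ on the same set $V$ with $d'\le d$ pointwise and $d'\ne d$. A cycle $C=(p_1,\dots,p_m)$ in $V$ is a cyclic sequence of (possibly repeated) points, and its length is $d(C)=d(p_1,p_2)+\dots+d(p_{m-1},p_m)+d(p_m,p_1)$. The extension $(V,d)$ is cyclically tight if there is no extension $(V,d')$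 of $(S,\mu)$ such that $d'(C)\le d(C)$ for all cycles $C$ in $V$ and $d'(C')<d(C')$ for some cycle $C'$. Let $S^c, S^r$ be two disjoint copies of $S$, with $s^c\in S^c$, $s^r\in S^r$ the copies of $s\in S$, and $S^{cr}=S^c\cup S^r$. For $p\in\mathbf{R}^{S^{cr}}$, $p^c$ and $p^r$ are its restrictions to $S^c$ and $S^r$. Vectors are compared coordinatewise; $p\le q$ means $\le$ in each coordinate, $p<q$ means strict inequality in every coordinate. A point $p$ of a set $P$ is minimal if there is no $q\in P$, $q\neq p$, with $q\le p$. Define $\Pi_\mu=\{p\in\mathbf{R}^{S^{cr}} : p(s^c)+p(t^r)\ge\mu(s,t)\ \forall s,t\in S\}$, $P_\mu=\Pi_\mu\cap\mathbf{R}_+^{S^{cr}}$, $T_\mu$ = the set of minimal elements of $P_\mu$, $Q_\mu$ = the set of minimal elements of $\Pi_\mu$, $Q_\mu^+=Q_\mu\cap\mathbf{R}_+^{S^{cr}}$. For $p,q\in\mathbf{R}^X$ ($X$ finite), $D_\infty^+(p,q)=\max_{x\in X}\max\{q(x)-p(x),0\}$. For $p,q\in\mathbf{R}^{S^{cr}}$, $D_\infty(p,q)=\max\{D_\infty^+(p^c,q^c),D_\infty^+(q^r,p^r)\}$; this is a directed metric. A subset $R\subseteq\mathbf{R}^{S^{cr}}$ is balanced if there is no pair $p,q\in R$ with $p^c<q^c$ or $p^r<q^r$. For $s\in S$, $\mu_s\in\mathbf{R}^{S^{cr}}$ is given by $\mu_s(t^c)=\mu(t,s)$, $\mu_s(t^r)=\mu(s,t)$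 $(t\in S)$. For $x\in V$, $d_x\in\mathbf{R}^{S^{cr}}$ is given by $d_x(s^c)=d(s,x)$, $d_x(s^r)=d(x,s)$ $(s\in S)$. *)

theory Defs
  imports Complex_Main "HOL-Library.FuncSet"
begin

section \<open>Directed metric spaces and their extensions\<close>

definition directed_distance_on :: "'a set \<Rightarrow> ('a \<Rightarrow> 'a \<Rightarrow> real) \<Rightarrow> bool" where
  "directed_distance_on V d \<longleftrightarrow>
     (\<forall>x\<in>V. \<forall>y\<in>V. 0 \<le> d x y) \<and> (\<forall>x\<in>V. d x x = 0)"

definition directed_metric_on :: "'a set \<Rightarrow> ('a \<Rightarrow> 'a \<Rightarrow> real) \<Rightarrow> bool" where
  "directed_metric_on V d \<longleftrightarrow>
     directed_distance_on V d \<and>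
     (\<forall>x\<in>V. \<forall>y\<in>V. \<forall>z\<in>V. d x z \<le> d x y + d y z)"

definition isometric_embedding ::
    "'a set \<Rightarrow> ('a \<Rightarrow> 'a \<Rightarrow> real) \<Rightarrow> 'b set \<Rightarrow> ('b \<Rightarrow> 'b \<Rightarrow> real) \<Rightarrow> ('a \<Rightarrow> 'b) \<Rightarrow> bool" where
  "isometric_embedding V d V' d' \<rho> \<longleftrightarrow>
     \<rho> \<in> V \<rightarrow> V' \<and> (\<forall>x\<in>V. \<forall>y\<in>V. d' (\<rho> x) (\<rho> y) = d x y)"

definition extension ::
    "'a set \<Rightarrow> ('a \<Rightarrow> 'a \<Rightarrow> real) \<Rightarrow> 'a set \<Rightarrow> ('a \<Rightarrow> 'a \<Rightarrow> real) \<Rightarrow> bool" where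
  "extension S \<mu> V d \<longleftrightarrow>
     directed_metric_on V d \<and> S \<subseteq> V \<and> (\<forall>s\<in>S. \<forall>t\<in>S. d s t = \<mu> s t)"

text \<open>A distance on \<open>V\<close> is a function on the whole type whose values outside \<open>V\<close> are
  irrelevant, so \<open>d' \<noteq> d\<close> means that they differ at some pair of points of \<open>V\<close>.\<close>

definition tight ::
    "'a set \<Rightarrow> ('a \<Rightarrow> 'a \<Rightarrow> real) \<Rightarrow> 'a set \<Rightarrow> ('a \<Rightarrow> 'a \<Rightarrow> real) \<Rightarrow> bool" where
  "tight S \<mu> V d \<longleftrightarrow>
     \<not> (\<exists>d'. extension S \<mu> V d' \<and>
             (\<forall>x\<in>V. \<forall>y\<in>V. d' x y \<le> d x y) \<and>
             (\<exists>x\<in>V. \<exists>y\<in>V. d' x y \<noteq> d x y))"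

text \<open>A cycle \<open>(p\<^sub>1, \<dots>, p\<^sub>m)\<close>, \<open>m \<ge> 1\<close>, is represented by the list of its points, starting
  anywhere; the index in the length is taken modulo \<open>m\<close>.\<close>

definition cycles :: "'a set \<Rightarrow> 'a list set" where
  "cycles V = {C \<in> lists V. C \<noteq> []}"

definition cycle_length :: "('a \<Rightarrow> 'a \<Rightarrow> real) \<Rightarrow> 'a list \<Rightarrow> real" where
  "cycle_length d C = (\<Sum>i<length C. d (C ! i) (C ! (Suc i mod length C)))"

definition cyclically_tight ::
    "'a set \<Rightarrow> ('a \<Rightarrow> 'a \<Rightarrow> real) \<Rightarrow> 'a set \<Rightarrow> ('a \<Rightarrow> 'a \<Rightarrow> real) \<Rightarrow> bool" where
  "cyclically_tight S \<mu> V d \<longleftrightarrow>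
     \<not> (\<exists>d'. extension S \<mu> V d' \<and>
             (\<forall>C\<in>cycles V. cycle_length d' C \<le> cycle_length d C) \<and>
             (\<exists>C\<in>cycles V. cycle_length d' C < cycle_length d C))"

section \<open>The polyhedra and their minimal elements\<close>

text \<open>The copies of \<open>s\<close> are \<open>s\<^sup>c = Inl s\<close> and \<open>s\<^sup>r = Inr s\<close>. The space \<open>\<real>\<^sup>X\<close> is
  \<open>X \<rightarrow>\<^sub>E UNIV\<close>: its elements are \<open>undefined\<close> outside \<open>X\<close>, so that equality
  of vectors is equality of functions.\<close>

definition S_c :: "'a set \<Rightarrow> ('a + 'a) set" where
  "S_c S = Inl ` S"

definition S_r :: "'a set \<Rightarrow> ('a + 'a) set" where
  "S_r S = Inr ` S"

definition S_cr :: "'a set \<Rightarrow> ('a + 'a) set" where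
  "S_cr S = S_c S \<union> S_r S"

definition c_part :: "'a set \<Rightarrow> ('a + 'a \<Rightarrow> real) \<Rightarrow> ('a + 'a \<Rightarrow> real)" where
  "c_part S p = restrict p (S_c S)"

definition r_part :: "'a set \<Rightarrow> ('a + 'a \<Rightarrow> real) \<Rightarrow> ('a + 'a \<Rightarrow> real)" where
  "r_part S p = restrict p (S_r S)"

definition vec_le :: "'x set \<Rightarrow> ('x \<Rightarrow> real) \<Rightarrow> ('x \<Rightarrow> real) \<Rightarrow> bool" where
  "vec_le X p q \<longleftrightarrow> (\<forall>x\<in>X. p x \<le> q x)"

text \<open>Strict inequality in every coordinate, unlike the strict part of \<open>vec_le\<close>.\<close>

definition vec_less :: "'x set \<Rightarrow> ('x \<Rightarrow> real) \<Rightarrow> ('x \<Rightarrow> real) \<Rightarrow> bool" where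
  "vec_less X p q \<longleftrightarrow> (\<forall>x\<in>X. p x < q x)"

definition minimal_points :: "'x set \<Rightarrow> ('x \<Rightarrow> real) set \<Rightarrow> ('x \<Rightarrow> real) set" where
  "minimal_points X P = {p \<in> P. \<not> (\<exists>q\<in>P. q \<noteq> p \<and> vec_le X q p)}"

definition Pi_poly :: "'a set \<Rightarrow> ('a \<Rightarrow> 'a \<Rightarrow> real) \<Rightarrow> ('a + 'a \<Rightarrow> real) set" where
  "Pi_poly S \<mu> = {p \<in> S_cr S \<rightarrow>\<^sub>E UNIV. \<forall>s\<in>S. \<forall>t\<in>S. p (Inl s) + p (Inr t) \<ge> \<mu> s t}"

definition P_poly :: "'a set \<Rightarrow> ('a \<Rightarrow> 'a \<Rightarrow> real) \<Rightarrow> ('a + 'a \<Rightarrow> real) set" where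
  "P_poly S \<mu> = Pi_poly S \<mu> \<inter> (S_cr S \<rightarrow>\<^sub>E {0..})"

definition T_span :: "'a set \<Rightarrow> ('a \<Rightarrow> 'a \<Rightarrow> real) \<Rightarrow> ('a + 'a \<Rightarrow> real) set" where
  "T_span S \<mu> = minimal_points (S_cr S) (P_poly S \<mu>)"

definition Q_set :: "'a set \<Rightarrow> ('a \<Rightarrow> 'a \<Rightarrow> real) \<Rightarrow> ('a + 'a \<Rightarrow> real) set" where
  "Q_set S \<mu> = minimal_points (S_cr S) (Pi_poly S \<mu>)"

definition Q_plus :: "'a set \<Rightarrow> ('a \<Rightarrow> 'a \<Rightarrow> real) \<Rightarrow> ('a + 'a \<Rightarrow> real) set" where
  "Q_plus S \<mu> = Q_set S \<mu> \<inter> (S_cr S \<rightarrow>\<^sub>E {0..})"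

text \<open>Only meaningful for finite nonempty \<open>X\<close>.\<close>

definition D_inf_plus :: "'x set \<Rightarrow> ('x \<Rightarrow> real) \<Rightarrow> ('x \<Rightarrow> real) \<Rightarrow> real" where
  "D_inf_plus X p q = Max ((\<lambda>x. max (q x - p x) 0) ` X)"

definition D_inf :: "'a set \<Rightarrow> ('a + 'a \<Rightarrow> real) \<Rightarrow> ('a + 'a \<Rightarrow> real) \<Rightarrow> real" where
  "D_inf S p q = max (D_inf_plus (S_c S) (c_part S p) (c_part S q))
                     (D_inf_plus (S_r S) (r_part S q) (r_part S p))"

definition balanced :: "'a set \<Rightarrow> ('a + 'a \<Rightarrow> real) set \<Rightarrow> bool" where
  "balanced S R \<longleftrightarrow>
     \<not> (\<exists>p\<in>R. \<exists>q\<in>R. vec_less (S_c S) (c_part S p) (c_part S q) \<or>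
                      vec_less (S_r S) (r_part S p) (r_part S q))"

text \<open>The vector \<open>d\<^sub>x\<close> with \<open>d\<^sub>x(s\<^sup>c) = d(s,x)\<close> and \<open>d\<^sub>x(s\<^sup>r) = d(x,s)\<close>;
  the vector \<open>\<mu>\<^sub>s\<close> is the same construction applied to \<open>\<mu>\<close> and \<open>s \<in> S\<close>.\<close>

definition dist_vec :: "'a set \<Rightarrow> ('a \<Rightarrow> 'a \<Rightarrow> real) \<Rightarrow> 'a \<Rightarrow> ('a + 'a \<Rightarrow> real)" where
  "dist_vec S d x = restrict (case_sum (\<lambda>s. d s x) (\<lambda>s. d x s)) (S_cr S)"

end

theory Submission
  imports Defs
begin

text \<open>
  The vectors \<open>d\<^sub>x\<close> of an extension \<open>d\<close> of \<open>\<mu>\<close> lie in \<open>P\<^sub>\<mu>\<close>, and the triangle inequality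
  gives \<open>D\<^sub>\<infinity>(d\<^sub>x, d\<^sub>y) \<le> d(x,y)\<close>. So distances can only decrease by pushing
  these vectors down to minimal ones and measuring \<open>D\<^sub>\<infinity>\<close> there; tightness means that
  nothing changes by doing so.

  The two halves of the theorem concern the same construction with and without the
  lower bound \<open>0\<close> on coordinates and distances. A set \<open>F \<subseteq> {0}\<close> of lower bounds records
  which of the two is meant: \<open>F = {0}\<close> gives \<open>P\<^sub>\<mu>\<close>, \<open>T\<^sub>\<mu>\<close> and \<open>D\<^sub>\<infinity>\<close>, while \<open>F = {}\<close> gives
  \<open>\<Pi>\<^sub>\<mu>\<close>, \<open>Q\<^sub>\<mu>\<close> and the variant \<open>gap\<close> of \<open>D\<^sub>\<infinity>\<close> that may be negative. Three facts are shown
  for both at once. Replacing \<open>p\<^sup>c\<close> by the least vector compatible with \<open>p\<^sup>r\<close>, and then \<open>p\<^sup>r\<close> by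
  the least vector compatible with the new \<open>p\<^sup>c\<close>, retracts the polyhedron onto its minimal
  points (\<open>project_minimal\<close>). This retraction does not increase \<open>gap\<close>
  (\<open>gap_project_le\<close>). The coordinates of a minimal point \<open>p\<close> are its distances from and to
  the points \<open>\<mu>\<^sub>s\<close> (\<open>gap_mu_vec\<close>), so that an isometric embedding that sends each \<open>s\<close> to \<open>\<mu>\<^sub>s\<close>
  can only be \<open>x \<mapsto> d\<^sub>x\<close> (\<open>embedding_eq_dist_vec\<close>).

  Tightness. The distances between the retracted vectors form an extension below
  \<open>d\<close>; if \<open>d\<close> is tight they equal \<open>d\<close>, and \<open>x \<mapsto> d\<^sub>x\<close> is an embedding. Conversely, if this map
  is isometric and every \<open>d\<^sub>x\<close> is minimal, then \<open>d' \<le> d\<close> forces \<open>d'\<^sub>x = d\<^sub>x\<close>, hence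
  \<open>d(x,y) = D\<^sub>\<infinity>(d'\<^sub>x, d'\<^sub>y) \<le> d'(x,y)\<close>.

  Cyclic tightness. Cycle lengths do not change when \<open>a(y) - a(x)\<close> is added to the
  distance from \<open>x\<close> to \<open>y\<close>, which corresponds to translating vectors along \<open>(1, -1)\<close>, a direction
  that leaves \<open>\<Pi>\<^sub>\<mu>\<close> invariant. If \<open>d\<close> is cyclically tight, retract onto \<open>Q\<^sub>\<mu>\<close> and use a potential
  \<open>a\<close> that makes the possibly negative distances nonnegative and vanishes on \<open>S\<close>; the result is an
  extension none of whose cycles is longer than before, and the cycles of two points show that it had the
  distances of \<open>d\<close> before the potential was added. Balancedness then holds because
  \<open>d\<^sub>x\<^sup>c < d\<^sub>y\<^sup>c\<close> would make the distance from \<open>y\<close> to \<open>x\<close> negative. Conversely, if the cycles of \<open>d'\<close>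
  are not longer than those of \<open>d\<close>, then the cycles \<open>(t, s, x)\<close> with \<open>s, t \<in> S\<close> and the minimality of
  \<open>d\<^sub>x\<close> in \<open>\<Pi>\<^sub>\<mu>\<close> force \<open>d'\<^sub>x = d\<^sub>x + a(x)(1, -1)\<close>; balancedness gives
  \<open>d'(x,y) \<ge> d(x,y) + a(y) - a(x)\<close>, so no cycle got shorter.
\<close>

section \<open>Minimal compatible vectors and distances with an optional lower bound\<close>

text \<open>The least \<open>g\<close>, bounded below by \<open>F\<close>, with \<open>g(s) + f(t) \<ge> \<mu>(s,t)\<close> for all \<open>t\<close>. With \<open>\<mu>\<close>
  transposed the roles of the two halves of a vector are exchanged. The two maps form
  an antitone Galois connection on vectors bounded below by \<open>F\<close>.\<close>

definition reflect ::
    "'a set \<Rightarrow> real set \<Rightarrow> ('a \<Rightarrow> 'a \<Rightarrow> real) \<Rightarrow> ('a \<Rightarrow> real) \<Rightarrow> 'a \<Rightarrow> real" where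
  "reflect S F \<mu> f s = Max (F \<union> (\<lambda>t. \<mu> s t - f t) ` S)"

text \<open>For \<open>F = {0}\<close> this is \<open>D\<^sub>\<infinity>\<close>. For \<open>F = {}\<close> it may be negative, still
  satisfies the triangle inequality, and, when its arguments are translated along \<open>(1, -1)\<close>,
  changes by the difference of the two translations.\<close>

definition gap :: "'a set \<Rightarrow> real set \<Rightarrow> ('a + 'a \<Rightarrow> real) \<Rightarrow> ('a + 'a \<Rightarrow> real) \<Rightarrow> real" where
  "gap S F p q =
     Max (F \<union> (\<lambda>s. q (Inl s) - p (Inl s)) ` S \<union> (\<lambda>s. p (Inr s) - q (Inr s)) ` S)"

lemma in_S_cr_iff [simp]: "Inl s \<in> S_cr S \<longleftrightarrow> s \<in> S" "Inr s \<in> S_cr S \<longleftrightarrow> s \<in> S"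
  by (auto simp: S_cr_def S_c_def S_r_def)

lemma ball_S_cr: "(\<forall>x\<in>S_cr S. P x) \<longleftrightarrow> (\<forall>s\<in>S. P (Inl s)) \<and> (\<forall>s\<in>S. P (Inr s))"
  by (auto simp: S_cr_def S_c_def S_r_def)

lemma vector_eqI:
  assumes "p \<in> S_cr S \<rightarrow>\<^sub>E A" "q \<in> S_cr S \<rightarrow>\<^sub>E B"
    and "\<And>s. s \<in> S \<Longrightarrow> p (Inl s) = q (Inl s)" "\<And>s. s \<in> S \<Longrightarrow> p (Inr s) = q (Inr s)"
  shows "p = q"
proof (rule PiE_ext)
  show "p \<in> S_cr S \<rightarrow>\<^sub>E UNIV" "q \<in> S_cr S \<rightarrow>\<^sub>E UNIV"
    using assms(1,2) by (auto simp: PiE_iff)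
  have "\<forall>x\<in>S_cr S. p x = q x"
    using assms(3,4) by (simp add: ball_S_cr)
  then show "\<And>x. x \<in> S_cr S \<Longrightarrow> p x = q x" by blast
qed

lemma dist_vec_apply:
  assumes "s \<in> S"
  shows "dist_vec S d x (Inl s) = d s x" "dist_vec S d x (Inr s) = d x s"
  using assms by (simp_all add: dist_vec_def)

lemma dist_vec_PiE: "dist_vec S d x \<in> S_cr S \<rightarrow>\<^sub>E UNIV"
  by (simp add: dist_vec_def)

lemma dist_vec_extension:
  assumes "extension S \<mu> V d" "s \<in> S"
  shows "dist_vec S d s = dist_vec S \<mu> s"
  using assms
  by (intro vector_eqI[OF dist_vec_PiE dist_vec_PiE]) (auto simp: dist_vec_apply extension_def)

lemma extension_facts:
  assumes "extension S \<mu> V d"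
  shows "S \<subseteq> V"
    and "\<And>x y. x \<in> V \<Longrightarrow> y \<in> V \<Longrightarrow> 0 \<le> d x y"
    and "\<And>x. x \<in> V \<Longrightarrow> d x x = 0"
    and "\<And>x y z. x \<in> V \<Longrightarrow> y \<in> V \<Longrightarrow> z \<in> V \<Longrightarrow> d x z \<le> d x y + d y z"
    and "\<And>s t. s \<in> S \<Longrightarrow> t \<in> S \<Longrightarrow> d s t = \<mu> s t"
  using assms by (auto simp: extension_def directed_metric_on_def directed_distance_on_def)

section \<open>The retraction onto minimal points\<close>

text \<open>Since \<open>F \<subseteq> {0}\<close>, the lower bounds in \<open>F\<close> are respected by adding nonnegative numbers and
  by adding two numbers that respect them. This is what the triangle inequality for
  \<open>gap\<close> and the nonexpansiveness of the retraction need.\<close>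

locale floored_polyhedron =
  fixes S :: "'a set" and \<mu> :: "'a \<Rightarrow> 'a \<Rightarrow> real" and F :: "real set"
  assumes finite_S: "finite S" and nonempty_S: "S \<noteq> {}"
    and metric: "directed_metric_on S \<mu>"
    and floor: "F \<subseteq> {0}"
begin

definition polyhedron :: "('a + 'a \<Rightarrow> real) set" where
  "polyhedron = {p \<in> Pi_poly S \<mu>. \<forall>x\<in>S_cr S. \<forall>z\<in>F. z \<le> p x}"

definition minimal_set :: "('a + 'a \<Rightarrow> real) set" where
  "minimal_set = minimal_points (S_cr S) polyhedron"

definition project :: "('a + 'a \<Rightarrow> real) \<Rightarrow> ('a + 'a \<Rightarrow> real)" where
  "project p =
     (let f = reflect S F \<mu> (\<lambda>t. p (Inr t))
      in restrict (case_sum f (reflect S F (\<lambda>t s. \<mu> s t) f)) (S_cr S))"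

lemma finite_F: "finite F"
  using floor finite_subset by blast

lemma mu_facts:
  assumes "s \<in> S" "t \<in> S"
  shows "0 \<le> \<mu> s t" "\<mu> s s = 0" "u \<in> S \<Longrightarrow> \<mu> s u \<le> \<mu> s t + \<mu> t u"
  using metric assms by (auto simp: directed_metric_on_def directed_distance_on_def)

text \<open>Upper bounds determine a maximum, so with these equivalences there is no need to ask
  where the maxima in \<open>reflect\<close> and \<open>gap\<close> are attained.\<close>

lemma reflect_le_iff:
  "reflect S F \<nu> f s \<le> r \<longleftrightarrow> (\<forall>z\<in>F. z \<le> r) \<and> (\<forall>t\<in>S. \<nu> s t \<le> f t + r)"
proof -
  have "finite (F \<union> (\<lambda>t. \<nu> s t - f t) ` S)" "F \<union> (\<lambda>t. \<nu> s t - f t) ` S \<noteq> {}"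
    using finite_S nonempty_S finite_F by auto
  then show ?thesis
    unfolding reflect_def by (auto simp: ball_Un algebra_simps)
qed

lemma reflect_less_iff:
  "reflect S F \<nu> f s < r \<longleftrightarrow> (\<forall>z\<in>F. z < r) \<and> (\<forall>t\<in>S. \<nu> s t < f t + r)"
proof -
  have "finite (F \<union> (\<lambda>t. \<nu> s t - f t) ` S)" "F \<union> (\<lambda>t. \<nu> s t - f t) ` S \<noteq> {}"
    using finite_S nonempty_S finite_F by auto
  then show ?thesis
    unfolding reflect_def by (auto simp: ball_Un algebra_simps)
qed

lemma reflect_ge:
  shows "z \<in> F \<Longrightarrow> z \<le> reflect S F \<nu> f s"
    and "t \<in> S \<Longrightarrow> \<nu> s t \<le> f t + reflect S F \<nu> f s"
  using reflect_le_iff[of \<nu> f s "reflect S F \<nu> f s"] by auto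

lemma gap_le_iff:
  "gap S F p q \<le> r \<longleftrightarrow>
     (\<forall>z\<in>F. z \<le> r) \<and> (\<forall>s\<in>S. q (Inl s) \<le> p (Inl s) + r) \<and> (\<forall>s\<in>S. p (Inr s) \<le> q (Inr s) + r)"
proof -
  let ?X = "F \<union> (\<lambda>s. q (Inl s) - p (Inl s)) ` S \<union> (\<lambda>s. p (Inr s) - q (Inr s)) ` S"
  have "finite ?X" "?X \<noteq> {}"
    using finite_S nonempty_S finite_F by auto
  then show ?thesis
    unfolding gap_def by (auto simp: ball_Un algebra_simps)
qed

lemma gap_less_iff:
  "gap S F p q < r \<longleftrightarrow>
     (\<forall>z\<in>F. z < r) \<and> (\<forall>s\<in>S. q (Inl s) < p (Inl s) + r) \<and> (\<forall>s\<in>S. p (Inr s) < q (Inr s) + r)"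
proof -
  let ?X = "F \<union> (\<lambda>s. q (Inl s) - p (Inl s)) ` S \<union> (\<lambda>s. p (Inr s) - q (Inr s)) ` S"
  have "finite ?X" "?X \<noteq> {}"
    using finite_S nonempty_S finite_F by auto
  then show ?thesis
    unfolding gap_def by (auto simp: ball_Un algebra_simps)
qed

lemma gap_ge:
  shows "z \<in> F \<Longrightarrow> z \<le> gap S F p q"
    and "s \<in> S \<Longrightarrow> q (Inl s) \<le> p (Inl s) + gap S F p q"
    and "s \<in> S \<Longrightarrow> p (Inr s) \<le> q (Inr s) + gap S F p q"
  using gap_le_iff[of p q "gap S F p q"] by auto

lemma gap_self: "gap S F p p = 0"
proof (rule antisym)
  show "gap S F p p \<le> 0"
    using floor by (auto simp: gap_le_iff)
  obtain s where "s \<in> S" using nonempty_S by blast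
  then show "0 \<le> gap S F p p" using gap_ge(2)[of s p p] by simp
qed

lemma gap_triangle: "gap S F p r \<le> gap S F p q + gap S F q r"
proof -
  have "z \<le> gap S F p q + gap S F q r" if "z \<in> F" for z
    using that floor gap_ge(1)[of z p q] gap_ge(1)[of z q r] by auto
  moreover have "r (Inl s) \<le> p (Inl s) + (gap S F p q + gap S F q r)" if "s \<in> S" for s
    using gap_ge(2)[OF that, of q p] gap_ge(2)[OF that, of r q] by linarith
  moreover have "p (Inr s) \<le> r (Inr s) + (gap S F p q + gap S F q r)" if "s \<in> S" for s
    using gap_ge(3)[OF that, of q r] gap_ge(3)[OF that, of p q] by linarith
  ultimately show ?thesis by (simp add: gap_le_iff)
qed

lemma polyhedron_iff:
  "p \<in> polyhedron \<longleftrightarrow> p \<in> S_cr S \<rightarrow>\<^sub>E UNIV \<and> (\<forall>s\<in>S. \<forall>t\<in>S. \<mu> s t \<le> p (Inl s) + p (Inr t)) \<and>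
     (\<forall>z\<in>F. \<forall>s\<in>S. z \<le> p (Inl s) \<and> z \<le> p (Inr s))"
  by (auto simp: polyhedron_def Pi_poly_def ball_S_cr)

lemma project_apply:
  assumes "s \<in> S"
  shows "project p (Inl s) = reflect S F \<mu> (\<lambda>t. p (Inr t)) s"
    and "project p (Inr s) = reflect S F (\<lambda>t s. \<mu> s t) (reflect S F \<mu> (\<lambda>t. p (Inr t))) s"
  using assms by (simp_all add: project_def Let_def)

lemma project_in_polyhedron: "project p \<in> polyhedron"
proof -
  have "\<mu> s t \<le> project p (Inl s) + project p (Inr t)" if "s \<in> S" "t \<in> S" for s t
    using reflect_ge(2)[OF that(1), of "\<lambda>t s. \<mu> s t" t] that by (simp add: project_apply)
  then show ?thesis
    by (auto simp: polyhedron_iff project_apply reflect_ge(1)) (simp_all add: project_def Let_def)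
qed

lemma project_le:
  assumes "p \<in> polyhedron" "s \<in> S"
  shows "project p (Inl s) \<le> p (Inl s)" "project p (Inr s) \<le> p (Inr s)"
proof -
  show "project p (Inl s) \<le> p (Inl s)"
    using assms by (auto simp: project_apply reflect_le_iff polyhedron_iff algebra_simps)
  show "project p (Inr s) \<le> p (Inr s)"
    using assms reflect_ge(2)[OF assms(2), of \<mu> _ "\<lambda>t. p (Inr t)"]
    by (auto simp: project_apply reflect_le_iff polyhedron_iff algebra_simps)
qed

text \<open>A smaller point \<open>q\<close> of the polyhedron is compatible with itself, hence \<open>q\<^sup>c\<close> is at least
  the reflection of \<open>q\<^sup>r\<close>, which is at least the reflection of \<open>p\<^sup>r\<close> since reflection reverses
  the order.\<close>

lemma minimalI:
  assumes "p \<in> polyhedron"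
    and l: "\<And>s. s \<in> S \<Longrightarrow> p (Inl s) \<le> reflect S F \<mu> (\<lambda>t. p (Inr t)) s"
    and r: "\<And>s. s \<in> S \<Longrightarrow> p (Inr s) \<le> reflect S F (\<lambda>t s. \<mu> s t) (\<lambda>t. p (Inl t)) s"
  shows "p \<in> minimal_set"
proof -
  have "q = p" if q: "q \<in> polyhedron" and le: "vec_le (S_cr S) q p" for q
  proof (rule vector_eqI)
    show "q \<in> S_cr S \<rightarrow>\<^sub>E UNIV" "p \<in> S_cr S \<rightarrow>\<^sub>E UNIV"
      using q assms(1) by (auto simp: polyhedron_iff)
    have le': "q (Inl s) \<le> p (Inl s)" "q (Inr s) \<le> p (Inr s)" if "s \<in> S" for s
      using le that by (auto simp: vec_le_def ball_S_cr)
    have feas: "\<mu> s t \<le> q (Inl s) + q (Inr t)" if "s \<in> S" "t \<in> S" for s t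
      using q that by (auto simp: polyhedron_iff)
    show "q (Inl s) = p (Inl s)" if s: "s \<in> S" for s
    proof (rule antisym[OF le'(1)[OF s]])
      have "reflect S F \<mu> (\<lambda>t. p (Inr t)) s \<le> q (Inl s)"
        unfolding reflect_le_iff using q s feas[OF s] le'(2) by (force simp: polyhedron_iff)
      then show "p (Inl s) \<le> q (Inl s)" using l[OF s] by linarith
    qed
    show "q (Inr s) = p (Inr s)" if s: "s \<in> S" for s
    proof (rule antisym[OF le'(2)[OF s]])
      have "reflect S F (\<lambda>t s. \<mu> s t) (\<lambda>t. p (Inl t)) s \<le> q (Inr s)"
        unfolding reflect_le_iff using q s feas[OF _ s] le'(1) by (force simp: polyhedron_iff)
      then show "p (Inr s) \<le> q (Inr s)" using r[OF s] by linarith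
    qed
  qed
  then show ?thesis
    using assms(1) by (auto simp: minimal_set_def minimal_points_def)
qed

lemma minimal_in_polyhedron: "p \<in> minimal_set \<Longrightarrow> p \<in> polyhedron"
  by (simp add: minimal_set_def minimal_points_def)

lemma minimalD: "p \<in> minimal_set \<Longrightarrow> q \<in> polyhedron \<Longrightarrow> vec_le (S_cr S) q p \<Longrightarrow> q = p"
  by (auto simp: minimal_set_def minimal_points_def)

text \<open>Reflecting three times is the same as reflecting once, as in every Galois
  connection. So the two halves of \<open>project p\<close> are reflections of each other.\<close>

lemma project_minimal:
  assumes "p \<in> polyhedron"
  shows "project p \<in> minimal_set"
proof (rule minimalI[OF project_in_polyhedron])
  fix s assume s: "s \<in> S"
  show "project p (Inl s) \<le> reflect S F \<mu> (\<lambda>t. project p (Inr t)) s"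
    unfolding project_apply(1)[OF s] reflect_le_iff
  proof (intro conjI ballI)
    show "z \<le> reflect S F \<mu> (\<lambda>t. project p (Inr t)) s" if "z \<in> F" for z
      using that by (rule reflect_ge)
    show "\<mu> s t \<le> p (Inr t) + reflect S F \<mu> (\<lambda>t. project p (Inr t)) s" if t: "t \<in> S" for t
      using reflect_ge(2)[OF t, of \<mu> s "\<lambda>t. project p (Inr t)"] project_le(2)[OF assms t]
      by linarith
  qed
  show "project p (Inr s) \<le> reflect S F (\<lambda>t s. \<mu> s t) (\<lambda>t. project p (Inl t)) s"
    unfolding project_apply(2)[OF s] reflect_le_iff
  proof (intro conjI ballI)
    show "z \<le> reflect S F (\<lambda>t s. \<mu> s t) (\<lambda>t. project p (Inl t)) s" if "z \<in> F" for z
      using that by (rule reflect_ge)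
    show "\<mu> t s \<le> reflect S F \<mu> (\<lambda>t. p (Inr t)) t +
        reflect S F (\<lambda>t s. \<mu> s t) (\<lambda>t. project p (Inl t)) s" if t: "t \<in> S" for t
      using reflect_ge(2)[OF t, of "\<lambda>t s. \<mu> s t" s "\<lambda>t. project p (Inl t)"]
      by (simp add: project_apply(1)[OF t])
  qed
qed

lemma project_fixes_minimal:
  assumes "p \<in> minimal_set"
  shows "project p = p"
  using assms project_le[OF minimal_in_polyhedron[OF assms]]
  by (intro minimalD project_in_polyhedron) (auto simp: vec_le_def ball_S_cr)

lemma minimal_eq_reflect:
  assumes "p \<in> minimal_set" "s \<in> S"
  shows "p (Inl s) = reflect S F \<mu> (\<lambda>t. p (Inr t)) s"
    and "p (Inr s) = reflect S F (\<lambda>t s. \<mu> s t) (\<lambda>t. p (Inl t)) s"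
proof -
  note fix_p = project_fixes_minimal[OF assms(1)]
  show "p (Inl s) = reflect S F \<mu> (\<lambda>t. p (Inr t)) s"
    using project_apply(1)[OF assms(2), of p] fix_p by simp
  have "p (Inr s) = reflect S F (\<lambda>t s. \<mu> s t) (reflect S F \<mu> (\<lambda>t. p (Inr t))) s"
    using project_apply(2)[OF assms(2), of p] fix_p by simp
  also have "\<dots> = reflect S F (\<lambda>t s. \<mu> s t) (\<lambda>t. p (Inl t)) s"
    using project_apply(1)[of _ p] fix_p by (simp add: reflect_def)
  finally show "p (Inr s) = reflect S F (\<lambda>t s. \<mu> s t) (\<lambda>t. p (Inl t)) s" .
qed

text \<open>If \<open>p\<^sup>r \<le> q\<^sup>r + g\<close>, then \<open>q\<^sup>r + g\<close> reflects to at most the reflection of \<open>p\<^sup>r\<close>, so the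
  reflection of \<open>q\<^sup>r\<close> exceeds that of \<open>p\<^sup>r\<close> by at most \<open>g\<close>. The second reflection repeats this
  with the roles of \<open>p\<close> and \<open>q\<close> exchanged.\<close>

lemma gap_project_le: "gap S F (project p) (project q) \<le> gap S F p q"
proof -
  let ?g = "gap S F p q"
  have c: "project q (Inl s) \<le> project p (Inl s) + ?g" if s: "s \<in> S" for s
  proof -
    have "z \<le> project p (Inl s) + ?g" if "z \<in> F" for z
      using that floor gap_ge(1)[OF that, of p q] reflect_ge(1)[OF that, of \<mu> "\<lambda>t. p (Inr t)" s]
      by (auto simp: project_apply s)
    moreover have "\<mu> s t \<le> q (Inr t) + (project p (Inl s) + ?g)" if t: "t \<in> S" for t
      using reflect_ge(2)[OF t, of \<mu> s "\<lambda>t. p (Inr t)"] gap_ge(3)[OF t, of p q]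
      by (simp add: project_apply s)
    ultimately show ?thesis
      by (simp add: project_apply(1)[OF s, of q] reflect_le_iff)
  qed
  have r: "project p (Inr t) \<le> project q (Inr t) + ?g" if t: "t \<in> S" for t
  proof -
    let ?f = "reflect S F \<mu> (\<lambda>t. p (Inr t))" and ?h = "reflect S F \<mu> (\<lambda>t. q (Inr t))"
    have "z \<le> project q (Inr t) + ?g" if "z \<in> F" for z
      using that floor gap_ge(1)[OF that, of p q] reflect_ge(1)[OF that, of "\<lambda>t s. \<mu> s t" ?h t]
      by (auto simp: project_apply t)
    moreover have "\<mu> s t \<le> ?f s + (project q (Inr t) + ?g)" if s: "s \<in> S" for s
      using reflect_ge(2)[OF s, of "\<lambda>t s. \<mu> s t" t ?h] c[OF s]
      by (simp add: project_apply s t)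
    ultimately show ?thesis
      by (simp add: project_apply(2)[OF t, of p] reflect_le_iff)
  qed
  show ?thesis
    using c r gap_ge(1) by (simp add: gap_le_iff)
qed

section \<open>Distance vectors\<close>

text \<open>The coordinates of \<open>\<mu>\<^sub>s\<close> at \<open>s\<^sup>c\<close> and \<open>s\<^sup>r\<close> are \<open>0\<close>, so the constraints that involve one of
  them already bound all other coordinates from below by those of \<open>\<mu>\<^sub>s\<close>.\<close>

lemma mu_vec_minimal:
  assumes "s \<in> S"
  shows "dist_vec S \<mu> s \<in> minimal_set"
proof (rule minimalI)
  have "\<mu> a b \<le> \<mu> a s + \<mu> s b" if "a \<in> S" "b \<in> S" for a b
    using mu_facts(3) that assms by blast
  then show "dist_vec S \<mu> s \<in> polyhedron"
    using assms floor mu_facts(1) dist_vec_PiE[of S \<mu> s]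
    by (auto simp: polyhedron_iff dist_vec_apply)
  fix t assume t: "t \<in> S"
  show "dist_vec S \<mu> s (Inl t) \<le> reflect S F \<mu> (\<lambda>t. dist_vec S \<mu> s (Inr t)) t"
    using reflect_ge(2)[OF assms, of \<mu> t "\<lambda>t. dist_vec S \<mu> s (Inr t)"] assms t mu_facts(2)[OF assms assms]
    by (simp add: dist_vec_apply)
  show "dist_vec S \<mu> s (Inr t) \<le> reflect S F (\<lambda>t s. \<mu> s t) (\<lambda>t. dist_vec S \<mu> s (Inl t)) t"
    using reflect_ge(2)[OF assms, of "\<lambda>t s. \<mu> s t" t "\<lambda>t. dist_vec S \<mu> s (Inl t)"] assms t
      mu_facts(2)[OF assms assms]
    by (simp add: dist_vec_apply)
qed

text \<open>The term of the maximum that belongs to \<open>s\<close> is \<open>p(s\<^sup>c)\<close>, respectively \<open>p(s\<^sup>r)\<close>. No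
  other term is larger: on one half because \<open>p\<close> satisfies the constraints of the
  polyhedron, on the other because the triangle inequality of \<open>\<mu>\<close> makes the halves of a
  minimal point, being reflections, nonexpansive with respect to \<open>\<mu>\<close>.\<close>

lemma gap_mu_vec:
  assumes p: "p \<in> minimal_set" and s: "s \<in> S"
  shows "gap S F (dist_vec S \<mu> s) p = p (Inl s)"
    and "gap S F p (dist_vec S \<mu> s) = p (Inr s)"
proof -
  have feas: "\<mu> a b \<le> p (Inl a) + p (Inr b)" if "a \<in> S" "b \<in> S" for a b
    using minimal_in_polyhedron[OF p] that by (simp add: polyhedron_iff)
  have fl: "z \<le> p (Inl a) \<and> z \<le> p (Inr a)" if "z \<in> F" "a \<in> S" for z a
    using minimal_in_polyhedron[OF p] that by (simp add: polyhedron_iff)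
  have l: "p (Inl t) \<le> \<mu> t s + p (Inl s)" if t: "t \<in> S" for t
  proof -
    have "reflect S F \<mu> (\<lambda>t. p (Inr t)) t \<le> \<mu> t s + p (Inl s)"
      unfolding reflect_le_iff
    proof (intro conjI ballI)
      show "z \<le> \<mu> t s + p (Inl s)" if "z \<in> F" for z
        using fl[OF that s] mu_facts(1)[OF t s] by linarith
      show "\<mu> t u \<le> p (Inr u) + (\<mu> t s + p (Inl s))" if u: "u \<in> S" for u
        using mu_facts(3)[OF t s u] feas[OF s u] by linarith
    qed
    then show ?thesis using minimal_eq_reflect(1)[OF p t] by simp
  qed
  have r: "p (Inr t) \<le> \<mu> s t + p (Inr s)" if t: "t \<in> S" for t
  proof -
    have "reflect S F (\<lambda>t s. \<mu> s t) (\<lambda>t. p (Inl t)) t \<le> \<mu> s t + p (Inr s)"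
      unfolding reflect_le_iff
    proof (intro conjI ballI)
      show "z \<le> \<mu> s t + p (Inr s)" if "z \<in> F" for z
        using fl[OF that s] mu_facts(1)[OF s t] by linarith
      show "\<mu> u t \<le> p (Inl u) + (\<mu> s t + p (Inr s))" if u: "u \<in> S" for u
        using mu_facts(3)[OF u s t] feas[OF u s] by linarith
    qed
    then show ?thesis using minimal_eq_reflect(2)[OF p t] by simp
  qed
  show "gap S F (dist_vec S \<mu> s) p = p (Inl s)"
  proof (rule antisym)
    show "gap S F (dist_vec S \<mu> s) p \<le> p (Inl s)"
      unfolding gap_le_iff using fl s l feas by (auto simp: dist_vec_apply algebra_simps)
    show "p (Inl s) \<le> gap S F (dist_vec S \<mu> s) p"
      using gap_ge(2)[OF s, of p "dist_vec S \<mu> s"] mu_facts(2)[OF s s] s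
      by (simp add: dist_vec_apply)
  qed
  show "gap S F p (dist_vec S \<mu> s) = p (Inr s)"
  proof (rule antisym)
    show "gap S F p (dist_vec S \<mu> s) \<le> p (Inr s)"
      unfolding gap_le_iff using fl s r feas by (auto simp: dist_vec_apply algebra_simps)
    show "p (Inr s) \<le> gap S F p (dist_vec S \<mu> s)"
      using gap_ge(3)[OF s, of p "dist_vec S \<mu> s"] mu_facts(2)[OF s s] s
      by (simp add: dist_vec_apply)
  qed
qed

lemma dist_vec_in_polyhedron:
  assumes "extension S \<mu> V d" "x \<in> V"
  shows "dist_vec S d x \<in> polyhedron"
proof -
  note ext = extension_facts[OF assms(1)]
  have "\<mu> s t \<le> d s x + d x t" if "s \<in> S" "t \<in> S" for s t
    using ext(1) ext(4)[of s x t] ext(5) that assms(2) by auto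
  moreover have "z \<le> d s x \<and> z \<le> d x s" if "s \<in> S" "z \<in> F" for s z
    using ext(1) ext(2)[of s x] ext(2)[of x s] that assms(2) floor by auto
  ultimately show ?thesis
    using dist_vec_PiE[of S d x] by (auto simp: polyhedron_iff dist_vec_apply)
qed

lemma gap_dist_vec_le:
  assumes "extension S \<mu> V d" "x \<in> V" "y \<in> V"
  shows "gap S F (dist_vec S d x) (dist_vec S d y) \<le> d x y"
proof -
  note ext = extension_facts[OF assms(1)]
  show ?thesis
    using ext(1) ext(2)[OF assms(2,3)] floor ext(4)[OF _ assms(2,3)] ext(4)[OF assms(2,3)]
    by (auto simp: gap_le_iff dist_vec_apply subset_iff add.commute)
qed

text \<open>By isometry, \<open>d(s,x)\<close> and \<open>d(x,s)\<close> are the distances between \<open>\<mu>\<^sub>s\<close> and \<open>\<rho>(x)\<close>, which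
  are the coordinates of \<open>\<rho>(x)\<close>.\<close>

lemma embedding_eq_dist_vec:
  assumes ext: "extension S \<mu> V d"
    and emb: "isometric_embedding V d minimal_set (gap S F) \<rho>"
    and \<rho>S: "\<forall>s\<in>S. \<rho> s = dist_vec S \<mu> s"
    and x: "x \<in> V"
  shows "\<rho> x = dist_vec S d x"
proof (rule vector_eqI[OF _ dist_vec_PiE])
  have \<rho>x: "\<rho> x \<in> minimal_set"
    and iso: "\<And>y z. y \<in> V \<Longrightarrow> z \<in> V \<Longrightarrow> gap S F (\<rho> y) (\<rho> z) = d y z"
    using emb x by (auto simp: isometric_embedding_def)
  show "\<rho> x \<in> S_cr S \<rightarrow>\<^sub>E UNIV"
    using minimal_in_polyhedron[OF \<rho>x] by (simp add: polyhedron_iff)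
  fix s assume s: "s \<in> S"
  then have "s \<in> V" using extension_facts(1)[OF ext] by blast
  then show "\<rho> x (Inl s) = dist_vec S d x (Inl s)" "\<rho> x (Inr s) = dist_vec S d x (Inr s)"
    using gap_mu_vec[OF \<rho>x s] iso[of s x] iso[of x s] \<rho>S s x by (simp_all add: dist_vec_apply)
qed

lemma gap_project_dist_vec_le:
  assumes "extension S \<mu> V d" "x \<in> V" "y \<in> V"
  shows "gap S F (project (dist_vec S d x)) (project (dist_vec S d y)) \<le> d x y"
  using gap_project_le gap_dist_vec_le[OF assms] by (rule order_trans)

lemma project_dist_vec_on_S:
  assumes "extension S \<mu> V d" "s \<in> S"
  shows "project (dist_vec S d s) = dist_vec S \<mu> s"
  using assms by (simp add: dist_vec_extension project_fixes_minimal mu_vec_minimal)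

lemma gap_mu_vecs:
  assumes "s \<in> S" "t \<in> S"
  shows "gap S F (dist_vec S \<mu> s) (dist_vec S \<mu> t) = \<mu> s t"
  using assms by (simp add: gap_mu_vec(1) mu_vec_minimal dist_vec_apply)

text \<open>The form in which both kinds of tightness are exploited: if retracting does not
  shorten any distance, then the retracted vectors define an isometric embedding, which
  has to be \<open>x \<mapsto> d\<^sub>x\<close>, so that the \<open>d\<^sub>x\<close> were minimal from the start.\<close>

lemma dist_vec_embedding:
  assumes ext: "extension S \<mu> V d"
    and eq: "\<And>x y. x \<in> V \<Longrightarrow> y \<in> V \<Longrightarrow>
      gap S F (project (dist_vec S d x)) (project (dist_vec S d y)) = d x y"
  shows "isometric_embedding V d minimal_set (gap S F) (dist_vec S d)"
proof -
  have "isometric_embedding V d minimal_set (gap S F) (\<lambda>x. project (dist_vec S d x))"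
    using eq project_minimal[OF dist_vec_in_polyhedron[OF ext]] by (auto simp: isometric_embedding_def)
  then have "project (dist_vec S d x) = dist_vec S d x" if "x \<in> V" for x
    using embedding_eq_dist_vec[OF ext _ _ that] project_dist_vec_on_S[OF ext] by blast
  then show ?thesis
    using eq project_minimal[OF dist_vec_in_polyhedron[OF ext]]
    by (force simp: isometric_embedding_def Pi_iff)
qed

end

section \<open>The two instances\<close>

lemma eq_if_same_upper_bounds: "(\<And>r. (a::real) \<le> r \<longleftrightarrow> b \<le> r) \<Longrightarrow> a = b"
  by (meson order_antisym order_refl)

lemma D_inf_plus_le_iff:
  assumes "finite X" "X \<noteq> {}"
  shows "D_inf_plus X p q \<le> r \<longleftrightarrow> 0 \<le> r \<and> (\<forall>x\<in>X. q x \<le> p x + r)"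
  using assms by (auto simp: D_inf_plus_def algebra_simps)

lemma floored_polyhedronI:
  assumes "finite S" "S \<noteq> {}" "directed_metric_on S \<mu>"
  shows "floored_polyhedron S \<mu> {0}" "floored_polyhedron S \<mu> {}"
  using assms by (simp_all add: floored_polyhedron_def)

lemma D_inf_eq_gap:
  assumes "finite S" "S \<noteq> {}" "directed_metric_on S \<mu>"
  shows "D_inf S = gap S {0}"
proof (intro ext eq_if_same_upper_bounds)
  interpret floored_polyhedron S \<mu> "{0}"
    using floored_polyhedronI(1)[OF assms] .
  fix p q r
  have fin: "finite (S_c S)" "S_c S \<noteq> {}" "finite (S_r S)" "S_r S \<noteq> {}"
    using assms by (simp_all add: S_c_def S_r_def)
  show "D_inf S p q \<le> r \<longleftrightarrow> gap S {0} p q \<le> r"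
    unfolding D_inf_def max.bounded_iff D_inf_plus_le_iff[OF fin(1,2)]
      D_inf_plus_le_iff[OF fin(3,4)] gap_le_iff
    by (auto simp: c_part_def r_part_def S_c_def S_r_def)
qed

lemma T_span_eq:
  assumes "floored_polyhedron S \<mu> {0}"
  shows "T_span S \<mu> = floored_polyhedron.minimal_set S \<mu> {0}"
proof -
  interpret floored_polyhedron S \<mu> "{0}" by fact
  have "P_poly S \<mu> = polyhedron"
    by (auto simp: P_poly_def polyhedron_def Pi_poly_def PiE_iff extensional_def)
  then show ?thesis by (simp add: T_span_def minimal_set_def)
qed

lemma Q_set_eq:
  assumes "floored_polyhedron S \<mu> {}"
  shows "Q_set S \<mu> = floored_polyhedron.minimal_set S \<mu> {}"
proof -
  interpret floored_polyhedron S \<mu> "{}" by fact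
  show ?thesis by (simp add: Q_set_def minimal_set_def polyhedron_def)
qed

text \<open>A nonnegative point that is minimal in \<open>\<Pi>\<^sub>\<mu>\<close> is also minimal in the subset \<open>P\<^sub>\<mu>\<close>. This
  lets the uniqueness of embeddings into \<open>T\<^sub>\<mu>\<close> cover embeddings into \<open>Q\<^sub>\<mu>\<^sup>+\<close>.\<close>

lemma Q_plus_subset_T_span: "Q_plus S \<mu> \<subseteq> T_span S \<mu>"
  by (auto simp: Q_plus_def T_span_def Q_set_def P_poly_def minimal_points_def)

section \<open>Lengths of cycles\<close>

text \<open>The potential differences telescope around the cycle: every position is the successor of
  exactly one position.\<close>

lemma cycle_length_potential:
  assumes "C \<noteq> []"
  shows "cycle_length (\<lambda>x y. d x y + a y - a x) C = cycle_length d C"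
proof -
  let ?m = "length C" and ?\<sigma> = "\<lambda>i. Suc i mod length C"
  have m: "?m > 0" using assms by simp
  have inj: "inj_on ?\<sigma> {..<?m}"
  proof (rule inj_onI)
    fix i j assume "i \<in> {..<?m}" "j \<in> {..<?m}" "?\<sigma> i = ?\<sigma> j"
    then show "i = j" by (auto simp: mod_Suc split: if_splits)
  qed
  moreover have "?\<sigma> ` {..<?m} = {..<?m}"
    using m by (intro endo_inj_surj inj) auto
  ultimately have "bij_betw ?\<sigma> {..<?m} {..<?m}"
    by (simp add: bij_betw_def)
  then have "(\<Sum>i<?m. a (C ! ?\<sigma> i)) = (\<Sum>i<?m. a (C ! i))"
    by (rule sum.reindex_bij_betw)
  then show ?thesis
    by (simp add: cycle_length_def sum.distrib sum_subtractf)
qed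

lemma cycle_length_mono:
  assumes "C \<in> cycles V" "\<And>x y. x \<in> V \<Longrightarrow> y \<in> V \<Longrightarrow> d' x y \<le> d x y"
  shows "cycle_length d' C \<le> cycle_length d C"
  unfolding cycle_length_def
proof (rule sum_mono)
  fix i assume i: "i \<in> {..<length C}"
  have C: "set C \<subseteq> V" "length C > 0" using assms(1) by (auto simp: cycles_def)
  have "C ! i \<in> V" "C ! (Suc i mod length C) \<in> V"
    using C i nth_mem[of i C] nth_mem[of "Suc i mod length C" C] by auto
  then show "d' (C ! i) (C ! (Suc i mod length C)) \<le> d (C ! i) (C ! (Suc i mod length C))"
    by (rule assms(2))
qed

lemma cycle_length_pair: "cycle_length d [x, y] = d x y + d y x"
  by (simp add: cycle_length_def lessThan_Suc)

lemma cycle_length_triple: "cycle_length d [x, y, z] = d x y + d y z + d z x"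
  by (simp add: cycle_length_def lessThan_Suc)

section \<open>Tight extensions\<close>

lemma tight_imp_embedding:
  assumes S: "finite S" "S \<noteq> {}" "directed_metric_on S \<mu>"
    and ext: "extension S \<mu> V d" and tight: "tight S \<mu> V d"
  shows "isometric_embedding V d (T_span S \<mu>) (D_inf S) (dist_vec S d)"
proof -
  interpret floored_polyhedron S \<mu> "{0}" using floored_polyhedronI(1)[OF S] .
  let ?e = "\<lambda>x y. gap S {0} (project (dist_vec S d x)) (project (dist_vec S d y))"
  have le: "?e x y \<le> d x y" if "x \<in> V" "y \<in> V" for x y
    using gap_project_dist_vec_le[OF ext that] .
  have "extension S \<mu> V ?e"
    using extension_facts(1)[OF ext] gap_ge(1) gap_self gap_triangle
    by (auto simp: extension_def directed_metric_on_def directed_distance_on_def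
        project_dist_vec_on_S[OF ext] gap_mu_vecs)
  then have "?e x y = d x y" if "x \<in> V" "y \<in> V" for x y
    using tight le that unfolding tight_def by blast
  then have "isometric_embedding V d minimal_set (gap S {0}) (dist_vec S d)"
    by (rule dist_vec_embedding[OF ext])
  then show ?thesis
    by (simp add: T_span_eq[OF floored_polyhedron_axioms] D_inf_eq_gap[OF S])
qed

lemma embedding_unique:
  assumes S: "finite S" "S \<noteq> {}" "directed_metric_on S \<mu>"
    and ext: "extension S \<mu> V d"
    and emb: "isometric_embedding V d (T_span S \<mu>) (D_inf S) \<rho>"
    and "\<forall>s\<in>S. \<rho> s = dist_vec S \<mu> s" "x \<in> V"
  shows "\<rho> x = dist_vec S d x"
proof -
  interpret floored_polyhedron S \<mu> "{0}" using floored_polyhedronI(1)[OF S] .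
  show ?thesis
    using embedding_eq_dist_vec[OF ext] assms(5-)
    by (simp add: T_span_eq[OF floored_polyhedron_axioms] D_inf_eq_gap[OF S])
qed

lemma embedding_imp_tight:
  assumes S: "finite S" "S \<noteq> {}" "directed_metric_on S \<mu>"
    and emb: "isometric_embedding V d (T_span S \<mu>) (D_inf S) (dist_vec S d)"
  shows "tight S \<mu> V d"
proof -
  interpret floored_polyhedron S \<mu> "{0}" using floored_polyhedronI(1)[OF S] .
  have minimal: "\<And>x. x \<in> V \<Longrightarrow> dist_vec S d x \<in> minimal_set"
    and iso: "\<And>x y. x \<in> V \<Longrightarrow> y \<in> V \<Longrightarrow> gap S {0} (dist_vec S d x) (dist_vec S d y) = d x y"
    using emb by (auto simp: isometric_embedding_def T_span_eq[OF floored_polyhedron_axioms] D_inf_eq_gap[OF S])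
  have "d' x y = d x y"
    if ext': "extension S \<mu> V d'" and le: "\<forall>x\<in>V. \<forall>y\<in>V. d' x y \<le> d x y" and V: "x \<in> V" "y \<in> V"
    for d' x y
  proof -
    have "dist_vec S d' z = dist_vec S d z" if "z \<in> V" for z
      using minimalD[OF minimal[OF that] dist_vec_in_polyhedron[OF ext' that]]
        le that extension_facts(1)[OF ext']
      by (auto simp: vec_le_def ball_S_cr dist_vec_apply subset_iff)
    then have "d x y \<le> d' x y"
      using gap_dist_vec_le[OF ext' V] iso[OF V] V by simp
    then show ?thesis using le V by force
  qed
  then show ?thesis unfolding tight_def by blast
qed

section \<open>Cyclically tight extensions\<close>

text \<open>Write \<open>q\<^sub>x\<close> for the retraction of \<open>d\<^sub>x\<close> to \<open>Q\<^sub>\<mu>\<close>. The distance from \<open>q\<^sub>x\<close> to \<open>q\<^sub>y\<close> can be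
  negative. The potential \<open>a(x)\<close>, the least coordinate of \<open>q\<^sub>x\<^sup>r\<close>, is the distance from \<open>q\<^sub>x\<close> to the nearest
  \<open>\<mu>\<^sub>s\<close>. As such it satisfies \<open>a(x) \<le> gap(q\<^sub>x, q\<^sub>y) + a(y)\<close>, which is the nonnegativity
  of the corrected distance, and it vanishes on \<open>S\<close>, so that the corrected distance still extends
  \<open>\<mu>\<close>.\<close>

lemma cyclically_tight_imp_embedding:
  assumes S: "finite S" "S \<noteq> {}" "directed_metric_on S \<mu>"
    and ext: "extension S \<mu> V d" and tight: "cyclically_tight S \<mu> V d"
  shows "isometric_embedding V d (Q_plus S \<mu>) (D_inf S) (dist_vec S d)"
    and "balanced S (dist_vec S d ` V)"
proof -
  interpret floored_polyhedron S \<mu> "{}" using floored_polyhedronI(2)[OF S] .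
  interpret T: floored_polyhedron S \<mu> "{0}" using floored_polyhedronI(1)[OF S] .
  note extd = extension_facts[OF ext]
  let ?q = "\<lambda>x. project (dist_vec S d x)"
  let ?g = "\<lambda>x y. gap S {} (?q x) (?q y)"
  define a where "a x = Min ((\<lambda>s. ?q x (Inr s)) ` S)" for x
  let ?e = "\<lambda>x y. ?g x y + a y - a x"
  have le: "?g x y \<le> d x y" if "x \<in> V" "y \<in> V" for x y
    using gap_project_dist_vec_le[OF ext that] .
  have nonneg: "0 \<le> ?e x y" for x y
  proof -
    have "a y \<in> (\<lambda>s. ?q y (Inr s)) ` S"
      unfolding a_def using S by (intro Min_in) auto
    then obtain s where s: "s \<in> S" "a y = ?q y (Inr s)" by blast
    have "a x \<le> ?q x (Inr s)" unfolding a_def using s S by simp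
    then show ?thesis using gap_ge(3)[OF s(1), of "?q x" "?q y"] s(2) by linarith
  qed
  have a_S: "a s = 0" if s: "s \<in> S" for s
  proof -
    have "a s = Min (\<mu> s ` S)"
      unfolding a_def project_dist_vec_on_S[OF ext s]
      by (rule arg_cong[of _ _ Min]) (auto simp: dist_vec_apply)
    also have "\<dots> = 0"
      using S s mu_facts by (intro Min_eqI) (auto intro: image_eqI[of _ _ s])
    finally show ?thesis .
  qed
  have ext_e: "extension S \<mu> V ?e"
    using extd(1) nonneg gap_self gap_triangle[of "?q _" "?q _" "?q _"]
    by (auto simp: extension_def directed_metric_on_def directed_distance_on_def
        project_dist_vec_on_S[OF ext] gap_mu_vecs a_S algebra_simps)
  have le_cycle: "cycle_length ?e C \<le> cycle_length d C" if C: "C \<in> cycles V" for C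
  proof -
    have "cycle_length ?e C = cycle_length ?g C"
      using C by (intro cycle_length_potential) (simp add: cycles_def)
    also have "\<dots> \<le> cycle_length d C"
      using C le by (rule cycle_length_mono)
    finally show ?thesis .
  qed
  \<comment> \<open>The lengths of the cycle \<open>(x, y)\<close> agree, and neither of its two steps was lengthened.\<close>
  have "?g x y = d x y" if V: "x \<in> V" "y \<in> V" for x y
  proof -
    have C: "[x, y] \<in> cycles V" using V by (simp add: cycles_def)
    have "\<not> cycle_length ?e [x, y] < cycle_length d [x, y]"
      using tight ext_e le_cycle C unfolding cyclically_tight_def by blast
    then show ?thesis
      using le[OF V] le[OF V(2,1)] by (simp add: cycle_length_pair)
  qed
  then have "isometric_embedding V d minimal_set (gap S {}) (dist_vec S d)"
    by (rule dist_vec_embedding[OF ext])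
  then have minimal: "\<And>x. x \<in> V \<Longrightarrow> dist_vec S d x \<in> minimal_set"
    and iso: "\<And>x y. x \<in> V \<Longrightarrow> y \<in> V \<Longrightarrow> gap S {} (dist_vec S d x) (dist_vec S d y) = d x y"
    by (auto simp: isometric_embedding_def)
  have "D_inf S (dist_vec S d x) (dist_vec S d y) = d x y" if V: "x \<in> V" "y \<in> V" for x y
  proof (rule antisym)
    show "D_inf S (dist_vec S d x) (dist_vec S d y) \<le> d x y"
      using T.gap_dist_vec_le[OF ext V] by (simp add: D_inf_eq_gap[OF S])
    have "gap S {} (dist_vec S d x) (dist_vec S d y) \<le> gap S {0} (dist_vec S d x) (dist_vec S d y)"
      unfolding gap_le_iff using T.gap_ge(2,3) by simp
    then show "d x y \<le> D_inf S (dist_vec S d x) (dist_vec S d y)"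
      by (simp add: iso[OF V] D_inf_eq_gap[OF S])
  qed
  moreover have "dist_vec S d x \<in> Q_plus S \<mu>" if x: "x \<in> V" for x
    using minimal[OF x] T.dist_vec_in_polyhedron[OF ext x]
    by (auto simp: Q_plus_def Q_set_eq[OF floored_polyhedron_axioms] T.polyhedron_def Pi_poly_def PiE_iff)
  ultimately show "isometric_embedding V d (Q_plus S \<mu>) (D_inf S) (dist_vec S d)"
    by (simp add: isometric_embedding_def)
  \<comment> \<open>Reflection reverses even the strict order in all coordinates: the maxima are over the
    finite set \<open>S\<close>, with no lower bound \<open>0\<close> that could make both sides equal.\<close>
  have opposite: "(\<forall>s\<in>S. p (Inl s) < q (Inl s)) \<longleftrightarrow> (\<forall>s\<in>S. q (Inr s) < p (Inr s))"
    if pq: "p \<in> minimal_set" "q \<in> minimal_set" for p q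
  proof -
    have f: "\<mu> s t \<le> r (Inl s) + r (Inr t)" if "r \<in> minimal_set" "s \<in> S" "t \<in> S" for r s t
      using minimal_in_polyhedron[OF that(1)] that(2,3) by (simp add: polyhedron_iff)
    have "q (Inr t) < p (Inr t)" if lt: "\<forall>s\<in>S. p (Inl s) < q (Inl s)" and t: "t \<in> S" for t
      unfolding minimal_eq_reflect(2)[OF pq(2) t] reflect_less_iff
      using lt f[OF pq(1) _ t] by force
    moreover have "p (Inl t) < q (Inl t)" if lt: "\<forall>s\<in>S. q (Inr s) < p (Inr s)" and t: "t \<in> S" for t
      unfolding minimal_eq_reflect(1)[OF pq(1) t] reflect_less_iff
      using lt f[OF pq(2) t] by force
    ultimately show ?thesis by blast
  qed
  have "\<not> (\<forall>s\<in>S. dist_vec S d x (Inl s) < dist_vec S d y (Inl s))" if V: "x \<in> V" "y \<in> V" for x y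
  proof
    assume "\<forall>s\<in>S. dist_vec S d x (Inl s) < dist_vec S d y (Inl s)"
    then have "gap S {} (dist_vec S d y) (dist_vec S d x) < 0"
      using opposite[OF minimal[OF V(1)] minimal[OF V(2)]] by (simp add: gap_less_iff)
    then show False using iso[OF V(2,1)] extd(2)[OF V(2,1)] by simp
  qed
  then show "balanced S (dist_vec S d ` V)"
    using opposite minimal
    by (auto simp: balanced_def vec_less_def c_part_def r_part_def S_c_def S_r_def)
qed

text \<open>That the translation \<open>a(x)\<close> is the same for all coordinates rests on the minimality of
  \<open>d\<^sub>x\<close> in \<open>\<Pi>\<^sub>\<mu>\<close>, where coordinates may become negative. Balancedness enters through the
  lower bound \<open>0\<close> in \<open>D\<^sub>\<infinity>\<close>: it ensures that some coordinate difference is at least \<open>0\<close>, so that the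
  distance is a maximum of coordinate differences, which follow the translations as \<open>0\<close> does not.\<close>

lemma embedding_imp_cyclically_tight:
  assumes S: "finite S" "S \<noteq> {}" "directed_metric_on S \<mu>"
    and extd: "extension S \<mu> V d"
    and emb: "isometric_embedding V d (Q_plus S \<mu>) (D_inf S) (dist_vec S d)"
    and bal: "balanced S (dist_vec S d ` V)"
  shows "cyclically_tight S \<mu> V d"
proof -
  interpret floored_polyhedron S \<mu> "{}" using floored_polyhedronI(2)[OF S] .
  interpret T: floored_polyhedron S \<mu> "{0}" using floored_polyhedronI(1)[OF S] .
  have minimal: "\<And>x. x \<in> V \<Longrightarrow> dist_vec S d x \<in> minimal_set"
    and iso: "\<And>x y. x \<in> V \<Longrightarrow> y \<in> V \<Longrightarrow> gap S {0} (dist_vec S d x) (dist_vec S d y) = d x y"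
    using emb
    by (auto simp: isometric_embedding_def Q_plus_def Q_set_eq[OF floored_polyhedron_axioms] D_inf_eq_gap[OF S])
  have "cycle_length d C \<le> cycle_length d' C"
    if ext': "extension S \<mu> V d'" and le: "\<forall>C\<in>cycles V. cycle_length d' C \<le> cycle_length d C"
      and C: "C \<in> cycles V" for d' C
  proof -
    note ext = extension_facts[OF ext']
    have "\<exists>a. \<forall>s\<in>S. d' s x = d s x + a \<and> d' x s = d x s - a" if x: "x \<in> V" for x
    proof -
      \<comment> \<open>The largest change of a distance to \<open>x\<close>, attained at \<open>u\<close>. The cycle \<open>(t, u, x)\<close> has the
        fixed side \<open>\<mu>(t,u)\<close> and so forces the distance from \<open>x\<close> to \<open>t\<close> down by \<open>a\<close> at least.\<close>
      define a where "a = Max ((\<lambda>s. d' s x - d s x) ` S)"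
      have "a \<in> (\<lambda>s. d' s x - d s x) ` S"
        unfolding a_def using S by (intro Max_in) auto
      then obtain u where u: "u \<in> S" "a = d' u x - d u x" by blast
      have c: "d' s x \<le> d s x + a" if "s \<in> S" for s
      proof -
        have "d' s x - d s x \<le> a" unfolding a_def using S that by (intro Max_ge) auto
        then show ?thesis by linarith
      qed
      have r: "d' x t \<le> d x t - a" if t: "t \<in> S" for t
      proof -
        have V: "u \<in> V" "t \<in> V" using u t ext(1) by auto
        have "[t, u, x] \<in> cycles V" using V x by (simp add: cycles_def)
        then have "cycle_length d' [t, u, x] \<le> cycle_length d [t, u, x]" using le by blast
        moreover have "d' t u = d t u"
          using ext(5) extension_facts(5)[OF extd] u t by simp
        ultimately show ?thesis
          using u(2) unfolding cycle_length_triple by linarith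
      qed
      \<comment> \<open>Translating \<open>d'\<^sub>x\<close> back keeps it in \<open>\<Pi>\<^sub>\<mu>\<close> and puts it below \<open>d\<^sub>x\<close>.\<close>
      let ?q = "restrict (case_sum (\<lambda>s. d' s x - a) (\<lambda>s. d' x s + a)) (S_cr S)"
      have "?q \<in> polyhedron"
        using dist_vec_in_polyhedron[OF ext' x]
        by (auto simp: polyhedron_iff  dist_vec_apply)
      moreover have "vec_le (S_cr S) ?q (dist_vec S d x)"
        using c r by (auto simp: vec_le_def ball_S_cr  dist_vec_apply algebra_simps)
      ultimately have eq: "?q = dist_vec S d x"
        by (rule minimalD[OF minimal[OF x]])
      have "d' s x = d s x + a \<and> d' x s = d x s - a" if "s \<in> S" for s
        using fun_cong[OF eq, of "Inl s"] fun_cong[OF eq, of "Inr s"] that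
        by (simp add:  dist_vec_apply)
      then show ?thesis by blast
    qed
    then obtain a where a: "\<And>x s. x \<in> V \<Longrightarrow> s \<in> S \<Longrightarrow> d' s x = d s x + a x"
      "\<And>x s. x \<in> V \<Longrightarrow> s \<in> S \<Longrightarrow> d' x s = d x s - a x"
      by metis
    have "d x y + a y - a x \<le> d' x y" if V: "x \<in> V" "y \<in> V" for x y
    proof -
      have c: "d s y \<le> d s x + (d' x y + a x - a y)" if "s \<in> S" for s
        using ext(1) ext(4)[of s x y] a(1)[of x s] a(1)[of y s] V that by auto
      have r: "d x s \<le> d y s + (d' x y + a x - a y)" if "s \<in> S" for s
        using ext(1) ext(4)[of x y s] a(2)[of x s] a(2)[of y s] V that by auto
      have "\<not> vec_less (S_c S) (c_part S (dist_vec S d y)) (c_part S (dist_vec S d x))"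
        using bal V unfolding balanced_def by blast
      then obtain s where "s \<in> S" "d s x \<le> d s y"
        by (auto simp: vec_less_def c_part_def S_c_def dist_vec_def S_cr_def not_less)
      then have "0 \<le> d' x y + a x - a y" using c[of s] by linarith
      then have "gap S {0} (dist_vec S d x) (dist_vec S d y) \<le> d' x y + a x - a y"
        using c r by (auto simp: T.gap_le_iff dist_vec_apply)
      then show ?thesis using iso[OF V] by linarith
    qed
    then have "cycle_length (\<lambda>x y. d x y + a y - a x) C \<le> cycle_length d' C"
      by (rule cycle_length_mono[OF C])
    then show ?thesis
      using C cycle_length_potential[of C d a] by (simp add: cycles_def)
  qed
  then show ?thesis unfolding cyclically_tight_def by (meson not_le)
qed

theorem theorem2p12:
  fixes S V :: "'a set" and \<mu> d :: "'a \<Rightarrow> 'a \<Rightarrow> real"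
  assumes "finite S" and "S \<noteq> {}"
    and "directed_metric_on S \<mu>"
    and "extension S \<mu> V d"
  shows
    "(tight S \<mu> V d \<longleftrightarrow>
       (\<exists>\<rho>. isometric_embedding V d (T_span S \<mu>) (D_inf S) \<rho> \<and>
            (\<forall>s\<in>S. \<rho> s = dist_vec S \<mu> s))) \<and>
     (cyclically_tight S \<mu> V d \<longleftrightarrow>
       (\<exists>\<rho>. isometric_embedding V d (Q_plus S \<mu>) (D_inf S) \<rho> \<and>
            (\<forall>s\<in>S. \<rho> s = dist_vec S \<mu> s) \<and> balanced S (\<rho> ` V))) \<and>
     (tight S \<mu> V d \<longrightarrow>
       (\<forall>\<rho>. (isometric_embedding V d (T_span S \<mu>) (D_inf S) \<rho> \<and>
             (\<forall>s\<in>S. \<rho> s = dist_vec S \<mu> s)) \<or>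
            (isometric_embedding V d (Q_plus S \<mu>) (D_inf S) \<rho> \<and>
             (\<forall>s\<in>S. \<rho> s = dist_vec S \<mu> s) \<and> balanced S (\<rho> ` V)) \<longrightarrow>
            (\<forall>x\<in>V. \<rho> x = dist_vec S d x)))"
proof -
  let ?T = "\<lambda>\<rho>. isometric_embedding V d (T_span S \<mu>) (D_inf S) \<rho> \<and> (\<forall>s\<in>S. \<rho> s = dist_vec S \<mu> s)"
  let ?Q = "\<lambda>\<rho>. isometric_embedding V d (Q_plus S \<mu>) (D_inf S) \<rho> \<and> (\<forall>s\<in>S. \<rho> s = dist_vec S \<mu> s) \<and>
              balanced S (\<rho> ` V)"
  have on_S: "\<forall>s\<in>S. dist_vec S d s = dist_vec S \<mu> s"
    using dist_vec_extension[OF assms(4)] by blast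
  have QT: "?T \<rho>" if "?Q \<rho>" for \<rho>
    using that Q_plus_subset_T_span[of S \<mu>] by (auto simp: isometric_embedding_def)
  have unique: "\<forall>x\<in>V. \<rho> x = dist_vec S d x" if "?T \<rho>" for \<rho>
    using embedding_unique[OF assms] that by blast
  have transfer: "isometric_embedding V d A (D_inf S) (dist_vec S d)"
    if "isometric_embedding V d A (D_inf S) \<rho>" "\<forall>x\<in>V. \<rho> x = dist_vec S d x" for \<rho> A
    using that by (auto simp: isometric_embedding_def Pi_iff)
  have "tight S \<mu> V d \<longleftrightarrow> (\<exists>\<rho>. ?T \<rho>)"
    using tight_imp_embedding[OF assms] embedding_imp_tight[OF assms(1-3)] on_S unique transfer
    by meson
  moreover have "cyclically_tight S \<mu> V d \<longleftrightarrow> (\<exists>\<rho>. ?Q \<rho>)"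
  proof
    assume "cyclically_tight S \<mu> V d"
    then show "\<exists>\<rho>. ?Q \<rho>"
      using cyclically_tight_imp_embedding[OF assms] on_S by blast
  next
    assume "\<exists>\<rho>. ?Q \<rho>"
    then obtain \<rho> where \<rho>: "?Q \<rho>" by blast
    then have eq: "\<forall>x\<in>V. \<rho> x = dist_vec S d x" using QT unique by blast
    then have "\<rho> ` V = dist_vec S d ` V" by auto
    then show "cyclically_tight S \<mu> V d"
      using embedding_imp_cyclically_tight[OF assms] \<rho> transfer eq by metis
  qed
  ultimately show ?thesis using QT unique by blast
qed

end
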